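(* The species $\mathscr{G}$ of graphs is the composition of the species $\mathscr{B}$ of bi-point-determining graphs and the species $\mathscr{C}$ of cographs: $$\mathscr{G}=\mathscr{B}\circ\mathscr{C}.$$
   Context: All graphs are finite and simple. A species $F$ is a functor from the category of finite sets with bijections to itself; equality of species means isomorphism (natural isomorphism). For a species of graphs, $F[U]$ is a set of graphs with vertex set $U$, with transport by relabeling. For $\Psi[\varnothing]=\varnothing$, a $\Phi\circ\Psi$-structure on $U$ is a partition $\pi$ of $U$ into nonempty blocks, a $\Phi$-structure on the set of blocks, and a $\Psi$-structure on each block. A graph is point-determining if distinct vertices have distinct neighborhoods (the neighborhood of a vertex being the set of vertices adjacent to it); a bi-point-determining graph is a point-determining graph whose complement is also point-determining. The empty graph is a graph and is regarded as bi-point-determining. Cographs are defined recursively: (i) a graph on a single vertex is a cograph; (ii) the disjoint union of a (nonempty, finite) set of cographs with pairwise disjoint vertex sets is a cograph; (iii) the complement of a cograph is a cograph. In particular cographs are nonempty. *)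

theory Defs
  imports "Graph_Theory.Pair_Digraph" "HOL-Library.Disjoint_Sets" "HOL-Library.FuncSet"
begin

section \<open>Species\<close>

text \<open>
  The objects of the category of finite sets are the finite sets over a label type \<open>'a\<close>, and its
  morphisms \<open>U \<rightarrow> V\<close> are the restrictions to \<open>U\<close> of the functions \<open>\<sigma>\<close> with \<open>bij_betw \<sigma> U V\<close>.
  \<open>structs F U\<close> is the set F[U]; \<open>transport F U \<sigma>\<close> is the map F[\<sigma>] from F[U] to F[V].
\<close>

record ('a, 's) species =
  structs :: "'a set \<Rightarrow> 's set"
  transport :: "'a set \<Rightarrow> ('a \<Rightarrow> 'a) \<Rightarrow> 's \<Rightarrow> 's"

text \<open>
  The last conjunct makes \<open>transport F U \<sigma>\<close> depend on the morphism only, i.e. on \<open>\<sigma>\<close> restricted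
  to \<open>U\<close>.
\<close>

definition is_species :: "('a, 's) species \<Rightarrow> bool" where
  "is_species F \<longleftrightarrow>
     (\<forall>U. finite U \<longrightarrow> finite (structs F U)) \<and>
     (\<forall>U V \<sigma>. finite U \<and> bij_betw \<sigma> U V \<longrightarrow>
        bij_betw (transport F U \<sigma>) (structs F U) (structs F V)) \<and>
     (\<forall>U. \<forall>s \<in> structs F U. finite U \<longrightarrow> transport F U id s = s) \<and>
     (\<forall>U V W \<sigma> \<tau>. \<forall>s \<in> structs F U. finite U \<and> bij_betw \<sigma> U V \<and> bij_betw \<tau> V W \<longrightarrow>
        transport F U (\<tau> \<circ> \<sigma>) s = transport F V \<tau> (transport F U \<sigma> s)) \<and>
     (\<forall>U V \<sigma> \<tau>. \<forall>s \<in> structs F U. finite U \<and> bij_betw \<sigma> U V \<and> (\<forall>u\<in>U. \<sigma> u = \<tau> u) \<longrightarrow>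
        transport F U \<sigma> s = transport F U \<tau> s)"

definition natural_iso ::
    "('a, 's) species \<Rightarrow> ('a, 't) species \<Rightarrow> ('a set \<Rightarrow> 's \<Rightarrow> 't) \<Rightarrow> bool" where
  "natural_iso F G \<alpha> \<longleftrightarrow>
     (\<forall>U. finite U \<longrightarrow> bij_betw (\<alpha> U) (structs F U) (structs G U)) \<and>
     (\<forall>U V \<sigma>. \<forall>s \<in> structs F U. finite U \<and> bij_betw \<sigma> U V \<longrightarrow>
        \<alpha> V (transport F U \<sigma> s) = transport G U \<sigma> (\<alpha> U s))"

definition species_iso :: "('a, 's) species \<Rightarrow> ('a, 't) species \<Rightarrow> bool" where
  "species_iso F G \<longleftrightarrow> is_species F \<and> is_species G \<and> (\<exists>\<alpha>. natural_iso F G \<alpha>)"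

text \<open>
  A structure of the composition on \<open>U\<close> is a triple \<open>(\<pi>, \<phi>, \<psi>)\<close>. The outer species is taken over
  the label type \<open>'a set\<close>, since its labels are the blocks of \<open>\<pi>\<close>. The family \<open>\<psi>\<close> is extensional
  (undefined outside \<open>\<pi>\<close>), so that equal families of structures are equal functions. The
  definition is meant for inner species \<open>\<Psi>\<close> without structures on the empty set.
\<close>

definition species_comp ::
    "('a set, 's) species \<Rightarrow> ('a, 't) species \<Rightarrow>
     ('a, 'a set set \<times> 's \<times> ('a set \<Rightarrow> 't)) species" where
  "species_comp \<Phi> \<Psi> =
     \<lparr> structs = (\<lambda>U. {(\<pi>, \<phi>, \<psi>). partition_on U \<pi> \<and> \<phi> \<in> structs \<Phi> \<pi> \<and>
                                 \<psi> \<in> (\<Pi>\<^sub>E B\<in>\<pi>. structs \<Psi> B)}),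
       transport = (\<lambda>U \<sigma> (\<pi>, \<phi>, \<psi>).
         (image \<sigma> ` \<pi>,
          transport \<Phi> \<pi> (image \<sigma>) \<phi>,
          (\<lambda>C \<in> image \<sigma> ` \<pi>. let B = the_inv_into \<pi> (image \<sigma>) C in transport \<Psi> B \<sigma> (\<psi> B)))) \<rparr>"


section \<open>Graphs\<close>

text \<open>
  A finite simple graph is a value \<open>G\<close> with \<open>pair_graph G\<close>, i.e. a finite vertex set \<open>pverts G\<close>
  (possibly empty) with an irreflexive and symmetric adjacency relation \<open>parcs G\<close> on it.
\<close>

definition relabel :: "('a \<Rightarrow> 'b) \<Rightarrow> 'a pair_pre_digraph \<Rightarrow> 'b pair_pre_digraph" where
  "relabel \<sigma> G = \<lparr> pverts = \<sigma> ` pverts G, parcs = map_prod \<sigma> \<sigma> ` parcs G \<rparr>"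

definition graph_complement :: "'a pair_pre_digraph \<Rightarrow> 'a pair_pre_digraph" where
  "graph_complement G =
     \<lparr> pverts = pverts G,
       parcs = {(u, v). u \<in> pverts G \<and> v \<in> pverts G \<and> u \<noteq> v \<and> (u, v) \<notin> parcs G} \<rparr>"

definition graph_Union :: "'a pair_pre_digraph set \<Rightarrow> 'a pair_pre_digraph" where
  "graph_Union S = \<lparr> pverts = (\<Union>G\<in>S. pverts G), parcs = (\<Union>G\<in>S. parcs G) \<rparr>"

definition neighborhood :: "'a pair_pre_digraph \<Rightarrow> 'a \<Rightarrow> 'a set" where
  "neighborhood G v = {u \<in> pverts G. (v, u) \<in> parcs G}"

definition point_determining :: "'a pair_pre_digraph \<Rightarrow> bool" where
  "point_determining G \<longleftrightarrow>
     (\<forall>u \<in> pverts G. \<forall>v \<in> pverts G. u \<noteq> v \<longrightarrow> neighborhood G u \<noteq> neighborhood G v)"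

definition bi_point_determining :: "'a pair_pre_digraph \<Rightarrow> bool" where
  "bi_point_determining G \<longleftrightarrow> point_determining G \<and> point_determining (graph_complement G)"

inductive cograph :: "'a pair_pre_digraph \<Rightarrow> bool" where
  single: "cograph \<lparr> pverts = {v}, parcs = {} \<rparr>"
| disjoint_union:
    "finite S \<Longrightarrow> S \<noteq> {} \<Longrightarrow> (\<forall>G\<in>S. cograph G) \<Longrightarrow>
     pairwise (\<lambda>G H. disjnt (pverts G) (pverts H)) S \<Longrightarrow> cograph (graph_Union S)"
| complement: "cograph G \<Longrightarrow> cograph (graph_complement G)"

definition species_of_graphs ::
    "('a pair_pre_digraph \<Rightarrow> bool) \<Rightarrow> ('a, 'a pair_pre_digraph) species" where
  "species_of_graphs P =
     \<lparr> structs = (\<lambda>U. {G. pair_graph G \<and> pverts G = U \<and> P G}),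
       transport = (\<lambda>U. relabel) \<rparr>"

definition graph_species :: "('a, 'a pair_pre_digraph) species" where
  "graph_species = species_of_graphs (\<lambda>G. True)"

definition bi_point_determining_species :: "('a, 'a pair_pre_digraph) species" where
  "bi_point_determining_species = species_of_graphs bi_point_determining"

definition cograph_species :: "('a, 'a pair_pre_digraph) species" where
  "cograph_species = species_of_graphs cograph"


section \<open>Well-definedness\<close>

lemma is_speciesI:
  assumes fin: "\<And>U. finite U \<Longrightarrow> finite (structs F U)"
    and maps: "\<And>U V \<sigma> s. finite U \<Longrightarrow> bij_betw \<sigma> U V \<Longrightarrow> s \<in> structs F U \<Longrightarrow>
      transport F U \<sigma> s \<in> structs F V"
    and ident: "\<And>U s. finite U \<Longrightarrow> s \<in> structs F U \<Longrightarrow> transport F U id s = s"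
    and comp: "\<And>U V W \<sigma> \<tau> s. finite U \<Longrightarrow> bij_betw \<sigma> U V \<Longrightarrow> bij_betw \<tau> V W \<Longrightarrow>
      s \<in> structs F U \<Longrightarrow> transport F U (\<tau> \<circ> \<sigma>) s = transport F V \<tau> (transport F U \<sigma> s)"
    and cong: "\<And>U V \<sigma> \<tau> s. finite U \<Longrightarrow> bij_betw \<sigma> U V \<Longrightarrow> (\<And>u. u \<in> U \<Longrightarrow> \<sigma> u = \<tau> u) \<Longrightarrow>
      s \<in> structs F U \<Longrightarrow> transport F U \<sigma> s = transport F U \<tau> s"
  shows "is_species F"
proof -
  have bij: "bij_betw (transport F U \<sigma>) (structs F U) (structs F V)"
    if U: "finite U" and \<sigma>: "bij_betw \<sigma> U V" for U V \<sigma>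
  proof (rule bij_betw_byWitness[where f' = "transport F V (the_inv_into U \<sigma>)"])
    let ?\<tau> = "the_inv_into U \<sigma>"
    have V: "finite V" using U \<sigma> bij_betw_finite by blast
    have \<tau>: "bij_betw ?\<tau> V U" using \<sigma> by (rule bij_betw_the_inv_into)
    show "\<forall>s\<in>structs F U. transport F V ?\<tau> (transport F U \<sigma> s) = s"
    proof
      fix s assume s: "s \<in> structs F U"
      have "transport F U (?\<tau> \<circ> \<sigma>) s = transport F U id s"
        using U \<sigma> by (intro cong[OF U bij_betw_trans[OF \<sigma> \<tau>] _ s])
          (auto simp: bij_betw_def the_inv_into_f_f)
      then show "transport F V ?\<tau> (transport F U \<sigma> s) = s"
        by (simp add: comp[OF U \<sigma> \<tau> s] ident[OF U s])
    qed
    show "\<forall>s\<in>structs F V. transport F U \<sigma> (transport F V ?\<tau> s) = s"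
    proof
      fix s assume s: "s \<in> structs F V"
      have "transport F V (\<sigma> \<circ> ?\<tau>) s = transport F V id s"
        using U \<sigma> by (intro cong[OF V bij_betw_trans[OF \<tau> \<sigma>] _ s])
          (auto simp: bij_betw_def f_the_inv_into_f)
      then show "transport F U \<sigma> (transport F V ?\<tau> s) = s"
        by (simp add: comp[OF V \<tau> \<sigma> s] ident[OF V s])
    qed
    show "transport F U \<sigma> ` structs F U \<subseteq> structs F V" using maps[OF U \<sigma>] by blast
    show "transport F V ?\<tau> ` structs F V \<subseteq> structs F U" using maps[OF V \<tau>] by blast
  qed
  show ?thesis
    unfolding is_species_def
    apply (intro conjI allI ballI impI)
    subgoal by (rule fin)
    subgoal by (blast intro: bij)
    subgoal by (rule ident)
    subgoal by (blast intro: comp)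
    subgoal by (blast intro: cong)
    done
qed

lemma
  assumes F: "is_species F" and U: "finite U" and s: "s \<in> structs F U"
  shows transport_in: "bij_betw \<sigma> U V \<Longrightarrow> transport F U \<sigma> s \<in> structs F V"
    and transport_id: "transport F U id s = s"
    and transport_comp: "bij_betw \<sigma> U V \<Longrightarrow> bij_betw \<tau> V W \<Longrightarrow>
      transport F U (\<tau> \<circ> \<sigma>) s = transport F V \<tau> (transport F U \<sigma> s)"
    and transport_cong: "bij_betw \<sigma> U V \<Longrightarrow> (\<And>u. u \<in> U \<Longrightarrow> \<sigma> u = \<tau> u) \<Longrightarrow>
      transport F U \<sigma> s = transport F U \<tau> s"
proof -
  note F' = F[unfolded is_species_def]
  show "transport F U id s = s"
    using conjunct1[OF conjunct2[OF conjunct2[OF F']]] U s by blast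
  show "transport F U \<sigma> s \<in> structs F V" if "bij_betw \<sigma> U V"
    using conjunct1[OF conjunct2[OF F']] U s that bij_betwE by blast
  show "transport F U (\<tau> \<circ> \<sigma>) s = transport F V \<tau> (transport F U \<sigma> s)"
    if "bij_betw \<sigma> U V" "bij_betw \<tau> V W"
    using conjunct1[OF conjunct2[OF conjunct2[OF conjunct2[OF F']]]] U s that by blast
  show "transport F U \<sigma> s = transport F U \<tau> s"
    if "bij_betw \<sigma> U V" "\<And>u. u \<in> U \<Longrightarrow> \<sigma> u = \<tau> u"
    using conjunct2[OF conjunct2[OF conjunct2[OF conjunct2[OF F']]]] U s that by blast
qed

lemma is_species_comp:
  assumes \<Phi>: "is_species \<Phi>" and \<Psi>: "is_species \<Psi>"
  shows "is_species (species_comp \<Phi> \<Psi>)"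
proof -
  let ?F = "species_comp \<Phi> \<Psi>"
  have structs: "(\<pi>, \<phi>, \<psi>) \<in> structs ?F U \<longleftrightarrow>
      partition_on U \<pi> \<and> \<phi> \<in> structs \<Phi> \<pi> \<and> \<psi> \<in> (\<Pi>\<^sub>E B\<in>\<pi>. structs \<Psi> B)" for U \<pi> \<phi> \<psi>
    by (simp add: species_comp_def)
  have inj: "inj_on (image \<sigma>) \<pi>" if "partition_on U \<pi>" "inj_on \<sigma> U"
    for U :: "'a set" and \<pi> and \<sigma> :: "'a \<Rightarrow> 'a"
    using that by (intro inj_on_image) (simp add: partition_on_def)
  define R where "R = (\<lambda>(\<sigma> :: 'a \<Rightarrow> 'a) \<pi> \<psi>. \<lambda>C \<in> image \<sigma> ` \<pi>.
      let B = the_inv_into \<pi> (image \<sigma>) C in transport \<Psi> B \<sigma> (\<psi> B))"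
  have trans: "transport ?F U \<sigma> (\<pi>, \<phi>, \<psi>) =
      (image \<sigma> ` \<pi>, transport \<Phi> \<pi> (image \<sigma>) \<phi>, R \<sigma> \<pi> \<psi>)" for U \<sigma> \<pi> \<phi> \<psi>
    by (simp add: species_comp_def R_def)
  have R: "R \<sigma> \<pi> \<psi> (\<sigma> ` B) = transport \<Psi> B \<sigma> (\<psi> B)"
    if "partition_on U \<pi>" "inj_on \<sigma> U" "B \<in> \<pi>" for U \<pi> \<sigma> \<psi> B
    using that inj[OF that(1,2)] by (simp add: R_def the_inv_into_f_f)
  have R_ext: "R \<sigma> \<pi> \<psi> \<in> extensional (image \<sigma> ` \<pi>)" for \<sigma> \<pi> \<psi>
    by (simp add: R_def)
  have blocks: "finite \<pi>" "\<And>B. B \<in> \<pi> \<Longrightarrow> finite B \<and> B \<subseteq> U"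
    if "partition_on U \<pi>" "finite U" for U :: "'a set" and \<pi>
    using that finite_elements[OF that(2,1)] by (auto simp: partition_on_def intro: finite_subset)
  have part: "partition_on V (image \<sigma> ` \<pi>)" if "partition_on U \<pi>" "bij_betw \<sigma> U V"
    for U V :: "'a set" and \<pi> and \<sigma> :: "'a \<Rightarrow> 'a"
  proof -
    have "{} \<notin> image \<sigma> ` \<pi>" using that(1) by (auto simp: partition_on_def)
    then show ?thesis using partition_on_inj_image[OF that(1), of \<sigma>] that(2)
      by (simp add: bij_betw_def)
  qed
  have sub: "bij_betw \<sigma> B (\<sigma> ` B)" if "bij_betw \<sigma> U V" "B \<subseteq> U" for \<sigma> :: "'a \<Rightarrow> 'a" and U V B
    using that by (auto simp: bij_betw_def intro: inj_on_subset)
  have outer: "bij_betw (image \<sigma>) \<pi> (image \<sigma> ` \<pi>)"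
    if "partition_on U \<pi>" "bij_betw \<sigma> U V" for U V :: "'a set" and \<pi> and \<sigma> :: "'a \<Rightarrow> 'a"
    using inj[OF that(1)] that(2) by (auto simp: bij_betw_def)
  have maps: "transport ?F U \<sigma> (\<pi>, \<phi>, \<psi>) \<in> structs ?F V"
    if U: "finite U" and \<sigma>: "bij_betw \<sigma> U V" and s: "(\<pi>, \<phi>, \<psi>) \<in> structs ?F U" for U V \<sigma> \<pi> \<phi> \<psi>
  proof -
    have p: "partition_on U \<pi>" and \<phi>: "\<phi> \<in> structs \<Phi> \<pi>"
      and \<psi>: "\<And>B. B \<in> \<pi> \<Longrightarrow> \<psi> B \<in> structs \<Psi> B"
      using s by (auto simp: structs)
    have "transport \<Phi> \<pi> (image \<sigma>) \<phi> \<in> structs \<Phi> (image \<sigma> ` \<pi>)"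
      by (rule transport_in[OF \<Phi> blocks(1)[OF p U] \<phi> outer[OF p \<sigma>]])
    moreover have "R \<sigma> \<pi> \<psi> (\<sigma> ` B) \<in> structs \<Psi> (\<sigma> ` B)" if B: "B \<in> \<pi>" for B
    proof -
      have "transport \<Psi> B \<sigma> (\<psi> B) \<in> structs \<Psi> (\<sigma> ` B)"
        using transport_in[OF \<Psi> _ \<psi>[OF B]] blocks(2)[OF p U B] sub[OF \<sigma>] by blast
      then show ?thesis using R[OF p _ B] \<sigma> by (simp add: bij_betw_def)
    qed
    ultimately show ?thesis
      using part[OF p \<sigma>] R_ext by (auto simp: trans structs PiE_def)
  qed
  show ?thesis
  proof (rule is_speciesI; (clarify)?)
    fix U :: "'a set" assume U: "finite U"
    have "structs ?F U \<subseteq> (SIGMA \<pi>:Pow (Pow U). structs \<Phi> \<pi> \<times> (\<Pi>\<^sub>E B\<in>\<pi>. structs \<Psi> B))"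
      by (auto simp: structs partition_on_def)
    moreover have "finite (structs \<Phi> \<pi> \<times> (\<Pi>\<^sub>E B\<in>\<pi>. structs \<Psi> B))" if "\<pi> \<in> Pow (Pow U)" for \<pi>
    proof -
      have "finite \<pi>" using that U by (auto intro: finite_subset)
      moreover have "finite (structs \<Psi> B)" if "B \<in> \<pi>" for B
        using that \<open>\<pi> \<in> Pow (Pow U)\<close> U \<Psi> unfolding is_species_def by (meson PowD finite_subset subsetD)
      ultimately show ?thesis
        using \<Phi> unfolding is_species_def by (simp add: finite_PiE)
    qed
    ultimately show "finite (structs ?F U)"
      using U by (meson finite_Pow_iff finite_SigmaI finite_subset)
  next
    fix U V :: "'a set" and \<sigma> :: "'a \<Rightarrow> 'a" and \<pi> \<phi> \<psi>
    assume "finite U" "bij_betw \<sigma> U V" "(\<pi>, \<phi>, \<psi>) \<in> structs ?F U"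
    then show "transport ?F U \<sigma> (\<pi>, \<phi>, \<psi>) \<in> structs ?F V" by (rule maps)
  next
    fix U :: "'a set" and \<pi> \<phi> \<psi> assume U: "finite U" and s: "(\<pi>, \<phi>, \<psi>) \<in> structs ?F U"
    then have p: "partition_on U \<pi>" by (simp add: structs)
    have im: "image id = (id :: 'a set \<Rightarrow> 'a set)" by auto
    have "R id \<pi> \<psi> = \<psi>"
    proof (rule extensionalityI)
      show "R id \<pi> \<psi> \<in> extensional \<pi>" using R_ext[of id \<pi> \<psi>] by simp
      show "\<psi> \<in> extensional \<pi>" using s by (auto simp: structs PiE_def)
      fix B assume B: "B \<in> \<pi>"
      then have "\<psi> B \<in> structs \<Psi> B" using s by (auto simp: structs)
      then have "transport \<Psi> B id (\<psi> B) = \<psi> B"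
        using transport_id[OF \<Psi>] blocks(2)[OF p U B] by blast
      then show "R id \<pi> \<psi> B = \<psi> B" using R[OF p _ B, of id \<psi>] by simp
    qed
    moreover have "transport \<Phi> \<pi> id \<phi> = \<phi>"
      using transport_id[OF \<Phi> blocks(1)[OF p U]] s by (simp add: structs)
    ultimately show "transport ?F U id (\<pi>, \<phi>, \<psi>) = (\<pi>, \<phi>, \<psi>)"
      by (simp add: trans im)
  next
    fix U V W :: "'a set" and \<sigma> \<tau> :: "'a \<Rightarrow> 'a" and \<pi> \<phi> \<psi>
    assume U: "finite U" and \<sigma>: "bij_betw \<sigma> U V" and \<tau>: "bij_betw \<tau> V W"
      and s: "(\<pi>, \<phi>, \<psi>) \<in> structs ?F U"
    have p: "partition_on U \<pi>" using s by (simp add: structs)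
    have V: "finite V" using U \<sigma> bij_betw_finite by blast
    have im: "image (\<tau> \<circ> \<sigma>) = image \<tau> \<circ> image \<sigma>" by (auto simp: fun_eq_iff)
    note p' = part[OF p \<sigma>] and \<tau>\<sigma> = bij_betw_trans[OF \<sigma> \<tau>]
    have "R (\<tau> \<circ> \<sigma>) \<pi> \<psi> = R \<tau> (image \<sigma> ` \<pi>) (R \<sigma> \<pi> \<psi>)"
    proof (rule extensionalityI)
      show "R (\<tau> \<circ> \<sigma>) \<pi> \<psi> \<in> extensional (image (\<tau> \<circ> \<sigma>) ` \<pi>)" by (rule R_ext)
      show "R \<tau> (image \<sigma> ` \<pi>) (R \<sigma> \<pi> \<psi>) \<in> extensional (image (\<tau> \<circ> \<sigma>) ` \<pi>)"
        using R_ext by (metis im image_comp)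
      fix C assume "C \<in> image (\<tau> \<circ> \<sigma>) ` \<pi>"
      then obtain B where B: "B \<in> \<pi>" and C: "C = (\<tau> \<circ> \<sigma>) ` B" by blast
      have "\<psi> B \<in> structs \<Psi> B" using s B by (auto simp: structs)
      moreover have "\<sigma> ` B \<subseteq> V" using \<sigma> blocks(2)[OF p U B] by (auto simp: bij_betw_def)
      ultimately have "transport \<Psi> B (\<tau> \<circ> \<sigma>) (\<psi> B) = transport \<Psi> (\<sigma> ` B) \<tau> (transport \<Psi> B \<sigma> (\<psi> B))"
        using blocks(2)[OF p U B] sub[OF \<sigma>, of B] sub[OF \<tau>, of "\<sigma> ` B"]
        by (intro transport_comp[OF \<Psi>]) auto
      moreover have "R (\<tau> \<circ> \<sigma>) \<pi> \<psi> ((\<tau> \<circ> \<sigma>) ` B) = transport \<Psi> B (\<tau> \<circ> \<sigma>) (\<psi> B)"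
        by (rule R[OF p bij_betw_imp_inj_on[OF \<tau>\<sigma>] B])
      moreover have "R \<tau> (image \<sigma> ` \<pi>) (R \<sigma> \<pi> \<psi>) (\<tau> ` (\<sigma> ` B)) =
          transport \<Psi> (\<sigma> ` B) \<tau> (transport \<Psi> B \<sigma> (\<psi> B))"
        using R[OF p' _ imageI[OF B]] R[OF p _ B] \<sigma> \<tau> by (simp add: bij_betw_def)
      ultimately show "R (\<tau> \<circ> \<sigma>) \<pi> \<psi> C = R \<tau> (image \<sigma> ` \<pi>) (R \<sigma> \<pi> \<psi>) C"
        by (simp only: C image_comp)
    qed
    moreover have "transport \<Phi> \<pi> (image \<tau> \<circ> image \<sigma>) \<phi> =
        transport \<Phi> (image \<sigma> ` \<pi>) (image \<tau>) (transport \<Phi> \<pi> (image \<sigma>) \<phi>)"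
      using transport_comp[OF \<Phi> blocks(1)[OF p U] _ outer[OF p \<sigma>] outer[OF p' \<tau>]] s
      by (simp add: structs)
    ultimately show "transport ?F U (\<tau> \<circ> \<sigma>) (\<pi>, \<phi>, \<psi>) =
        transport ?F V \<tau> (transport ?F U \<sigma> (\<pi>, \<phi>, \<psi>))"
      by (simp only: trans im image_comp)
  next
    fix U V :: "'a set" and \<sigma> \<tau> :: "'a \<Rightarrow> 'a" and \<pi> \<phi> \<psi>
    assume U: "finite U" and \<sigma>: "bij_betw \<sigma> U V" and eq: "\<And>u. u \<in> U \<Longrightarrow> \<sigma> u = \<tau> u"
      and s: "(\<pi>, \<phi>, \<psi>) \<in> structs ?F U"
    have p: "partition_on U \<pi>" using s by (simp add: structs)
    have \<tau>: "bij_betw \<tau> U V" using \<sigma> bij_betw_cong[of U \<sigma> \<tau> V] eq by simp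
    have imB: "\<sigma> ` B = \<tau> ` B" if "B \<in> \<pi>" for B
      using eq blocks(2)[OF p U that] by (intro image_cong) auto
    then have im: "image \<sigma> ` \<pi> = image \<tau> ` \<pi>" by (rule image_cong[OF refl])
    have "R \<sigma> \<pi> \<psi> = R \<tau> \<pi> \<psi>"
    proof (rule extensionalityI)
      show "R \<sigma> \<pi> \<psi> \<in> extensional (image \<sigma> ` \<pi>)" by (rule R_ext)
      show "R \<tau> \<pi> \<psi> \<in> extensional (image \<sigma> ` \<pi>)" unfolding im by (rule R_ext)
      fix C assume "C \<in> image \<sigma> ` \<pi>"
      then obtain B where B: "B \<in> \<pi>" and C: "C = \<sigma> ` B" by blast
      have "\<psi> B \<in> structs \<Psi> B" using s B by (auto simp: structs)
      moreover have "\<forall>u\<in>B. \<sigma> u = \<tau> u" using eq blocks(2)[OF p U B] by blast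
      ultimately have "transport \<Psi> B \<sigma> (\<psi> B) = transport \<Psi> B \<tau> (\<psi> B)"
        using blocks(2)[OF p U B] sub[OF \<sigma>, of B]
        by (intro transport_cong[OF \<Psi>, where V = "\<sigma> ` B"]) auto
      moreover have "R \<sigma> \<pi> \<psi> (\<sigma> ` B) = transport \<Psi> B \<sigma> (\<psi> B)"
        using R[OF p _ B] \<sigma> by (simp add: bij_betw_def)
      moreover have "R \<tau> \<pi> \<psi> (\<tau> ` B) = transport \<Psi> B \<tau> (\<psi> B)"
        using R[OF p _ B] \<tau> by (simp add: bij_betw_def)
      ultimately show "R \<sigma> \<pi> \<psi> C = R \<tau> \<pi> \<psi> C"
        using C imB[OF B] by simp
    qed
    moreover have "transport \<Phi> \<pi> (image \<sigma>) \<phi> = transport \<Phi> \<pi> (image \<tau>) \<phi>"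
      using transport_cong[OF \<Phi> blocks(1)[OF p U] _ outer[OF p \<sigma>], of \<phi> "image \<tau>"] imB s
      by (simp add: structs)
    ultimately show "transport ?F U \<sigma> (\<pi>, \<phi>, \<psi>) = transport ?F U \<tau> (\<pi>, \<phi>, \<psi>)"
      by (simp add: trans im)
  qed
qed

lemma pair_graph_iff:
  "pair_graph G \<longleftrightarrow> finite (pverts G) \<and> parcs G \<subseteq> pverts G \<times> pverts G \<and> sym (parcs G) \<and>
     irrefl (parcs G)"
proof
  assume "pair_graph G"
  then interpret pair_graph G .
  show "finite (pverts G) \<and> parcs G \<subseteq> pverts G \<times> pverts G \<and> sym (parcs G) \<and> irrefl (parcs G)"
    using pair_finite_verts in_arcsD1 in_arcsD2 pair_no_loops pair_sym_arcs
    by (fastforce simp: irrefl_def symmetric_def)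
next
  assume *: "finite (pverts G) \<and> parcs G \<subseteq> pverts G \<times> pverts G \<and> sym (parcs G) \<and> irrefl (parcs G)"
  then have "finite (parcs G)" by (meson finite_SigmaI finite_subset)
  with * show "pair_graph G"
    by unfold_locales (auto simp: irrefl_def symmetric_def)
qed

lemma cograph_imp_pair_graph: "cograph G \<Longrightarrow> pair_graph G \<and> pverts G \<noteq> {}"
proof (induction rule: cograph.induct)
  case (disjoint_union S)
  then have "sym (\<Union>G\<in>S. parcs G)" unfolding sym_def pair_graph_iff by blast
  with disjoint_union show ?case
    by (auto simp: pair_graph_iff graph_Union_def irrefl_def)
qed (auto simp: pair_graph_iff graph_complement_def sym_def irrefl_def)

lemma cograph_species_empty: "structs cograph_species {} = {}"
  using cograph_imp_pair_graph by (auto simp: cograph_species_def species_of_graphs_def)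

lemma relabel_in_arcs_iff:
  assumes "pair_graph G" "inj_on \<sigma> (pverts G)" "u \<in> pverts G" "v \<in> pverts G"
  shows "(\<sigma> u, \<sigma> v) \<in> parcs (relabel \<sigma> G) \<longleftrightarrow> (u, v) \<in> parcs G"
proof
  assume "(\<sigma> u, \<sigma> v) \<in> parcs (relabel \<sigma> G)"
  then obtain x y where xy: "(x, y) \<in> parcs G" "\<sigma> u = \<sigma> x" "\<sigma> v = \<sigma> y"
    by (auto simp: relabel_def)
  moreover from xy(1) assms(1) have "x \<in> pverts G" "y \<in> pverts G"
    by (auto simp: pair_graph_iff)
  ultimately show "(u, v) \<in> parcs G"
    using assms(2-4) by (metis inj_onD)
next
  assume "(u, v) \<in> parcs G"
  then show "(\<sigma> u, \<sigma> v) \<in> parcs (relabel \<sigma> G)"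
    by (auto simp: relabel_def intro: rev_image_eqI)
qed

lemma pair_graph_relabel:
  assumes "pair_graph G" "inj_on \<sigma> (pverts G)"
  shows "pair_graph (relabel \<sigma> G)"
proof -
  have "irrefl (parcs (relabel \<sigma> G))"
    using assms unfolding pair_graph_iff relabel_def irrefl_def
    by (auto dest!: inj_onD)
  moreover have "sym (parcs (relabel \<sigma> G))"
  proof (rule symI)
    fix a b assume "(a, b) \<in> parcs (relabel \<sigma> G)"
    then obtain u v where "(u, v) \<in> parcs G" "a = \<sigma> u" "b = \<sigma> v"
      by (auto simp: relabel_def)
    moreover from this assms(1) have "(v, u) \<in> parcs G"
      by (auto simp: pair_graph_iff dest: symD)
    ultimately show "(b, a) \<in> parcs (relabel \<sigma> G)"
      by (auto simp: relabel_def intro: rev_image_eqI)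
  qed
  ultimately show ?thesis
    using assms(1) by (auto simp: pair_graph_iff relabel_def)
qed

lemma relabel_cong:
  assumes "pair_graph G" "\<And>u. u \<in> pverts G \<Longrightarrow> \<sigma> u = \<tau> u"
  shows "relabel \<sigma> G = relabel \<tau> G"
proof -
  have "map_prod \<sigma> \<sigma> e = map_prod \<tau> \<tau> e" if "e \<in> parcs G" for e
    using assms that unfolding pair_graph_iff by (cases e) auto
  with assms(2) show ?thesis by (simp add: relabel_def cong: image_cong)
qed

lemma relabel_comp: "relabel (\<tau> \<circ> \<sigma>) G = relabel \<tau> (relabel \<sigma> G)"
  by (simp add: relabel_def image_comp map_prod.comp)

lemma relabel_id: "relabel id G = G"
  by (simp add: relabel_def map_prod.id)

lemma relabel_complement:
  assumes "pair_graph G" "inj_on \<sigma> (pverts G)"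
  shows "relabel \<sigma> (graph_complement G) = graph_complement (relabel \<sigma> G)"
proof -
  have "parcs (relabel \<sigma> (graph_complement G)) = parcs (graph_complement (relabel \<sigma> G))"
  proof (intro set_eqI iffI)
    fix e assume "e \<in> parcs (relabel \<sigma> (graph_complement G))"
    then obtain u v where "e = (\<sigma> u, \<sigma> v)" "u \<in> pverts G" "v \<in> pverts G" "u \<noteq> v" "(u, v) \<notin> parcs G"
      by (auto simp: relabel_def graph_complement_def)
    with relabel_in_arcs_iff[OF assms] assms(2) show "e \<in> parcs (graph_complement (relabel \<sigma> G))"
      by (auto simp: graph_complement_def relabel_def dest: inj_onD)
  next
    fix e assume e: "e \<in> parcs (graph_complement (relabel \<sigma> G))"
    then obtain u v where uv: "e = (\<sigma> u, \<sigma> v)" "u \<in> pverts G" "v \<in> pverts G" "u \<noteq> v"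
      by (auto simp: relabel_def graph_complement_def)
    with e relabel_in_arcs_iff[OF assms] have "(u, v) \<notin> parcs G"
      by (auto simp: graph_complement_def)
    with uv show "e \<in> parcs (relabel \<sigma> (graph_complement G))"
      by (auto simp: relabel_def graph_complement_def intro!: image_eqI[of _ _ "(u, v)"])
  qed
  then show ?thesis by (simp add: relabel_def graph_complement_def)
qed

lemma pair_graph_complement: "pair_graph G \<Longrightarrow> pair_graph (graph_complement G)"
  by (auto simp: pair_graph_iff graph_complement_def sym_def irrefl_def)

lemma point_determining_relabel:
  assumes "pair_graph G" "inj_on \<sigma> (pverts G)" "point_determining G"
  shows "point_determining (relabel \<sigma> G)"
proof -
  have verts: "pverts (relabel \<sigma> G) = \<sigma> ` pverts G" by (simp add: relabel_def)
  have nb: "neighborhood (relabel \<sigma> G) (\<sigma> v) = \<sigma> ` neighborhood G v" if "v \<in> pverts G" for v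
    using relabel_in_arcs_iff[OF assms(1,2) that] unfolding neighborhood_def verts by blast
  have "neighborhood G v \<subseteq> pverts G" for v by (auto simp: neighborhood_def)
  with assms(2,3) show ?thesis
    unfolding point_determining_def verts by (auto simp: nb inj_on_image_eq_iff)
qed

lemma bi_point_determining_relabel:
  assumes "pair_graph G" "inj_on \<sigma> (pverts G)" "bi_point_determining G"
  shows "bi_point_determining (relabel \<sigma> G)"
proof -
  have "pverts (graph_complement G) = pverts G" by (simp add: graph_complement_def)
  with assms show ?thesis
    unfolding bi_point_determining_def
    by (metis pair_graph_complement point_determining_relabel relabel_complement)
qed

lemma cograph_relabel:
  "cograph G \<Longrightarrow> inj_on \<sigma> (pverts G) \<Longrightarrow> cograph (relabel \<sigma> G)"
proof (induction rule: cograph.induct)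
  case (single v)
  show ?case using cograph.single[of "\<sigma> v"] by (simp add: relabel_def)
next
  case (disjoint_union S)
  have sub: "pverts G \<subseteq> pverts (graph_Union S)" if "G \<in> S" for G
    using that by (auto simp: graph_Union_def)
  have "relabel \<sigma> (graph_Union S) = graph_Union (relabel \<sigma> ` S)"
    by (simp add: relabel_def graph_Union_def image_UN)
  moreover have "cograph (graph_Union (relabel \<sigma> ` S))"
  proof (rule cograph.disjoint_union)
    show "\<forall>G\<in>relabel \<sigma> ` S. cograph G"
      using disjoint_union sub by (auto intro: inj_on_subset)
    show "pairwise (\<lambda>G H. disjnt (pverts G) (pverts H)) (relabel \<sigma> ` S)"
    proof (rule pairwise_imageI)
      fix G H assume "G \<in> S" "H \<in> S" "G \<noteq> H"
      moreover from this have "pverts G \<inter> pverts H = {}"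
        using disjoint_union by (auto simp: pairwise_def disjnt_def)
      ultimately show "disjnt (pverts (relabel \<sigma> G)) (pverts (relabel \<sigma> H))"
        using sub disjoint_union.prems
        by (simp add: relabel_def disjnt_def inj_on_image_Int[symmetric])
    qed
  qed (use disjoint_union in auto)
  ultimately show ?case by simp
next
  case (complement G)
  then have "inj_on \<sigma> (pverts G)" by (simp add: graph_complement_def)
  with complement show ?case
    using cograph.complement relabel_complement cograph_imp_pair_graph by metis
qed

lemma is_species_of_graphs:
  fixes P :: "'a pair_pre_digraph \<Rightarrow> bool"
  assumes P: "\<And>G \<sigma>. pair_graph G \<Longrightarrow> inj_on \<sigma> (pverts G) \<Longrightarrow> P G \<Longrightarrow> P (relabel \<sigma> G)"
  shows "is_species (species_of_graphs P)"
proof -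
  let ?S = "\<lambda>U. {G. pair_graph G \<and> pverts G = U \<and> P G}"
  have fin: "finite (?S U)" if "finite U" for U
  proof (rule finite_subset)
    show "?S U \<subseteq> (\<lambda>E. \<lparr>pverts = U, parcs = E\<rparr>) ` Pow (U \<times> U)"
    proof
      fix G assume "G \<in> ?S U"
      then show "G \<in> (\<lambda>E. \<lparr>pverts = U, parcs = E\<rparr>) ` Pow (U \<times> U)"
        by (intro image_eqI[of _ _ "parcs G"]) (auto simp: pair_graph_iff)
    qed
    show "finite ((\<lambda>E. \<lparr>pverts = U, parcs = E\<rparr>) ` Pow (U \<times> U))" using that by simp
  qed
  have maps: "relabel \<sigma> G \<in> ?S V" if "bij_betw \<sigma> U V" "G \<in> ?S U" for U V \<sigma> G
    using that P[of G \<sigma>] pair_graph_relabel[of G \<sigma>]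
    by (auto simp: bij_betw_def) (auto simp: relabel_def)
  show ?thesis
    by (rule is_speciesI)
      (use fin maps in \<open>auto simp: species_of_graphs_def relabel_id relabel_comp intro!: relabel_cong\<close>)
qed

lemma is_species_graph_species: "is_species graph_species"
  unfolding graph_species_def by (rule is_species_of_graphs) simp

lemma is_species_bi_point_determining_species: "is_species bi_point_determining_species"
  unfolding bi_point_determining_species_def
  by (rule is_species_of_graphs) (rule bi_point_determining_relabel)

lemma is_species_cograph_species: "is_species cograph_species"
  unfolding cograph_species_def by (rule is_species_of_graphs) (rule cograph_relabel)

end

theory Submission
  imports Defs
begin

text \<open>
  A set of vertices is a module of a graph if no vertex outside the set distinguishes two vertices
  inside it. A structure of the composition on \<open>U\<close> is the same thing as a graph on \<open>U\<close> together
  with a partition of \<open>U\<close> into modules that induce cographs, such that the quotient graph is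
  bi-point-determining: the outer graph is the quotient, the inner graphs are the induced ones,
  and \<open>substitution\<close> reassembles the graph from them. So the theorem says that every graph has
  exactly one such partition, and this partition consists of the maximal cograph modules.

  \<^item> The maximal cograph modules are a partition. If two cograph modules \<open>M\<close> and \<open>N\<close>
    overlap, then \<open>M\<close> is either completely joined to \<open>N - M\<close> or has no edge to it, so their union
    is again a cograph module (\<open>cograph_module_Un\<close>).
  \<^item> Its quotient is bi-point-determining. A graph is bi-point-determining if and only if it has no
    twins (\<open>bi_point_determining_iff_no_twins\<close>), and the union of two blocks that are twins in the
    quotient would be a larger cograph module.
  \<^item> There is no other such partition. A maximal cograph module that contains a block of such a
    partition is a union of blocks. If these were two or more, then one representative of each
    would form a cograph, since induced subgraphs of cographs are cographs. A cograph with at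
    least two vertices has twins (\<open>cograph_has_twins\<close>), and the blocks of these twins would
    be twins in the quotient.

  Substitution visibly commutes with relabeling, so naturality is proved for the direction from the
  composition to graphs, and the maximal modules never have to be transported.
\<close>

section \<open>Induced subgraphs and twins\<close>

definition induced :: "'a pair_pre_digraph \<Rightarrow> 'a set \<Rightarrow> 'a pair_pre_digraph" where
  "induced G W = \<lparr> pverts = W, parcs = parcs G \<inter> W \<times> W \<rparr>"

definition twins :: "'a pair_pre_digraph \<Rightarrow> 'a \<Rightarrow> 'a \<Rightarrow> bool" where
  "twins G u v \<longleftrightarrow> u \<in> pverts G \<and> v \<in> pverts G \<and> u \<noteq> v \<and>
     (\<forall>w \<in> pverts G - {u, v}. (u, w) \<in> parcs G \<longleftrightarrow> (v, w) \<in> parcs G)"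

lemma induced_simps [simp]:
  "pverts (induced G W) = W"
  "parcs (induced G W) = parcs G \<inter> W \<times> W"
  by (simp_all add: induced_def)

lemma graph_complement_simps [simp]:
  "pverts (graph_complement G) = pverts G"
  "parcs (graph_complement G) =
     {(u, v). u \<in> pverts G \<and> v \<in> pverts G \<and> u \<noteq> v \<and> (u, v) \<notin> parcs G}"
  by (simp_all add: graph_complement_def)

lemma graph_eqI: "pverts G = pverts H \<Longrightarrow> parcs G = parcs H \<Longrightarrow> G = (H :: 'a pair_pre_digraph)"
  by simp

lemma pair_graphD:
  assumes "pair_graph G"
  shows "finite (pverts G)"
    and "(u, v) \<in> parcs G \<Longrightarrow> u \<in> pverts G \<and> v \<in> pverts G"
    and "(u, v) \<in> parcs G \<Longrightarrow> (v, u) \<in> parcs G"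
    and "(u, u) \<notin> parcs G"
  using assms by (auto simp: pair_graph_iff irrefl_def dest: symD)

lemma pair_graph_sym_iff: "pair_graph G \<Longrightarrow> (u, v) \<in> parcs G \<longleftrightarrow> (v, u) \<in> parcs G"
  by (blast intro: pair_graphD(3))

lemma pair_graph_induced: "pair_graph G \<Longrightarrow> W \<subseteq> pverts G \<Longrightarrow> pair_graph (induced G W)"
  by (auto simp: pair_graph_iff irrefl_def sym_def intro: finite_subset)

lemma complement_complement:
  assumes "pair_graph G"
  shows "graph_complement (graph_complement G) = G"
  using pair_graphD[OF assms] by (intro graph_eqI) auto

lemma induced_complement:
  "W \<subseteq> pverts G \<Longrightarrow> induced (graph_complement G) W = graph_complement (induced G W)"
  by (intro graph_eqI) auto

lemma twins_complement: "twins (graph_complement G) u v \<longleftrightarrow> twins G u v"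
  by (auto simp: twins_def)

lemma neighborhood_eq_imp_twins:
  assumes "u \<in> pverts G" "v \<in> pverts G" "u \<noteq> v" "neighborhood G u = neighborhood G v"
  shows "twins G u v"
  using assms by (auto simp: twins_def neighborhood_def set_eq_iff)

lemma nonadjacent_twins_neighborhood_eq:
  assumes "pair_graph G" "twins G u v" "(u, v) \<notin> parcs G"
  shows "neighborhood G u = neighborhood G v"
  using assms(2,3) pair_graphD(3,4)[OF assms(1)]
  unfolding twins_def neighborhood_def by blast

text \<open>
  Twins that are not adjacent have equal neighborhoods in the graph, and twins that are adjacent
  have equal neighborhoods in the complement.
\<close>

lemma bi_point_determining_iff_no_twins:
  assumes G: "pair_graph G"
  shows "bi_point_determining G \<longleftrightarrow> (\<forall>u v. \<not> twins G u v)"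
proof
  assume b: "bi_point_determining G"
  show "\<forall>u v. \<not> twins G u v"
  proof (intro allI notI)
    fix u v assume t: "twins G u v"
    then have uv: "u \<in> pverts G" "v \<in> pverts G" "u \<noteq> v" by (auto simp: twins_def)
    show False
    proof (cases "(u, v) \<in> parcs G")
      case False
      with nonadjacent_twins_neighborhood_eq[OF G t] b uv show False
        by (auto simp: bi_point_determining_def point_determining_def)
    next
      case True
      then have "neighborhood (graph_complement G) u = neighborhood (graph_complement G) v"
        using t by (intro nonadjacent_twins_neighborhood_eq pair_graph_complement[OF G])
          (auto simp: twins_complement)
      with b uv show False
        by (auto simp: bi_point_determining_def point_determining_def)
    qed
  qed
next
  assume no: "\<forall>u v. \<not> twins G u v"
  then show "bi_point_determining G"
    unfolding bi_point_determining_def point_determining_def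
    using neighborhood_eq_imp_twins[of _ G] neighborhood_eq_imp_twins[of _ "graph_complement G"]
    by (auto simp: twins_complement simp del: graph_complement_simps(2))
qed


section \<open>Cographs\<close>

text \<open>
  Complementation preserves twins. In a disjoint union, twins of one part are twins of the whole;
  if no part has two vertices, then there are no edges and any two vertices are twins.
\<close>

lemma cograph_has_twins:
  assumes "cograph G" "x \<in> pverts G" "y \<in> pverts G" "x \<noteq> y"
  shows "\<exists>u v. twins G u v"
  using assms
proof (induction arbitrary: x y rule: cograph.induct)
  case (single v)
  then show ?case by simp
next
  case (complement G)
  then show ?case by (simp add: twins_complement)
next
  case (disjoint_union S)
  have pg: "pair_graph G" if "G \<in> S" for G
    using disjoint_union.IH that cograph_imp_pair_graph by blast
  have same: "G = H" if "G \<in> S" "H \<in> S" "z \<in> pverts G" "z \<in> pverts H" for G H z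
    using disjoint_union.hyps that by (auto simp: pairwise_def disjnt_def)
  show ?case
  proof (cases "\<exists>G\<in>S. \<exists>a\<in>pverts G. \<exists>b\<in>pverts G. a \<noteq> b")
    case True
    then obtain G a b where G: "G \<in> S" and "a \<in> pverts G" "b \<in> pverts G" "a \<noteq> b" by blast
    then obtain u v where t: "twins G u v" using disjoint_union.IH by blast
    then have uv: "u \<in> pverts G" "v \<in> pverts G" by (auto simp: twins_def)
    have "(z, w) \<in> parcs (graph_Union S) \<longleftrightarrow> (z, w) \<in> parcs G" if "z \<in> pverts G" for z w
    proof
      assume "(z, w) \<in> parcs (graph_Union S)"
      then obtain H where H: "H \<in> S" "(z, w) \<in> parcs H" by (auto simp: graph_Union_def)
      with pair_graphD(2)[OF pg[OF H(1)]] same[OF G H(1) that] show "(z, w) \<in> parcs G" by blast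
    qed (use G in \<open>auto simp: graph_Union_def\<close>)
    moreover have "(z, w) \<notin> parcs G" if "w \<notin> pverts G" for z w
      using pair_graphD(2)[OF pg[OF G]] that by blast
    moreover have "pverts G \<subseteq> pverts (graph_Union S)"
      using G by (auto simp: graph_Union_def)
    ultimately have "twins (graph_Union S) u v"
      using t uv unfolding twins_def by blast
    then show ?thesis by blast
  next
    case False
    have "(u, w) \<notin> parcs (graph_Union S)" for u w
    proof
      assume "(u, w) \<in> parcs (graph_Union S)"
      then obtain G where "G \<in> S" "(u, w) \<in> parcs G" by (auto simp: graph_Union_def)
      with pair_graphD(2,4)[OF pg[of G]] False show False by metis
    qed
    with disjoint_union.prems have "twins (graph_Union S) x y" by (auto simp: twins_def)
    then show ?thesis by blast
  qed
qed

lemma cograph_induced: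
  assumes "cograph G" "W \<subseteq> pverts G" "W \<noteq> {}"
  shows "cograph (induced G W)"
  using assms
proof (induction arbitrary: W rule: cograph.induct)
  case (single v)
  then have "induced \<lparr>pverts = {v}, parcs = {}\<rparr> W = \<lparr>pverts = {v}, parcs = {}\<rparr>"
    by (intro graph_eqI) auto
  then show ?case by (simp add: cograph.single)
next
  case (complement G)
  then show ?case by (simp add: induced_complement cograph.complement)
next
  case (disjoint_union S)
  have pg: "pair_graph G" if "G \<in> S" for G
    using disjoint_union.IH that cograph_imp_pair_graph by blast
  let ?r = "\<lambda>G. induced G (pverts G \<inter> W)"
  \<comment> \<open>The members of \<open>S\<close> that miss \<open>W\<close> are dropped, since cographs are nonempty.\<close>
  let ?T = "{G \<in> S. pverts G \<inter> W \<noteq> {}}"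
  have "induced (graph_Union S) W = graph_Union (?r ` ?T)"
  proof (rule graph_eqI)
    show "pverts (induced (graph_Union S) W) = pverts (graph_Union (?r ` ?T))"
      using disjoint_union.prems(1) by (fastforce simp: graph_Union_def)
    show "parcs (induced (graph_Union S) W) = parcs (graph_Union (?r ` ?T))"
      using pair_graphD(2)[OF pg] by (fastforce simp: graph_Union_def)
  qed
  moreover have "cograph (graph_Union (?r ` ?T))"
  proof (rule cograph.disjoint_union)
    show "?r ` ?T \<noteq> {}" using disjoint_union.prems by (auto simp: graph_Union_def)
    show "\<forall>G\<in>?r ` ?T. cograph G" using disjoint_union.IH by auto
    show "pairwise (\<lambda>G H. disjnt (pverts G) (pverts H)) (?r ` ?T)"
      using disjoint_union.hyps by (fastforce simp: pairwise_def disjnt_def)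
  qed (use disjoint_union.hyps in auto)
  ultimately show ?case by simp
qed

lemma cograph_induced_Un_nonadjacent:
  assumes G: "pair_graph G" and "P \<inter> Q = {}"
    and "cograph (induced G P)" "cograph (induced G Q)"
    and no: "\<And>p q. p \<in> P \<Longrightarrow> q \<in> Q \<Longrightarrow> (p, q) \<notin> parcs G"
  shows "cograph (induced G (P \<union> Q))"
proof -
  have "(q, p) \<notin> parcs G" if "p \<in> P" "q \<in> Q" for p q
    using no[OF that] pair_graphD(3)[OF G] by blast
  with no have "induced G (P \<union> Q) = graph_Union {induced G P, induced G Q}"
    by (intro graph_eqI) (auto simp: graph_Union_def)
  moreover have "cograph (graph_Union {induced G P, induced G Q})"
    using assms(2-4)
    by (intro cograph.disjoint_union) (auto simp: pairwise_def disjnt_def)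
  ultimately show ?thesis by simp
qed

text \<open>The join of two cographs is the complement of the disjoint union of their complements.\<close>

lemma cograph_induced_Un:
  assumes G: "pair_graph G" and PQ: "P \<subseteq> pverts G" "Q \<subseteq> pverts G" "P \<inter> Q = {}"
    and P: "cograph (induced G P)" and Q: "cograph (induced G Q)"
    and uniform: "\<And>p q. p \<in> P \<Longrightarrow> q \<in> Q \<Longrightarrow> (p, q) \<in> parcs G \<longleftrightarrow> b"
  shows "cograph (induced G (P \<union> Q))"
proof (cases b)
  case False
  with uniform show ?thesis by (intro cograph_induced_Un_nonadjacent[OF G PQ(3) P Q]) auto
next
  case True
  let ?G = "graph_complement G"
  have "cograph (induced ?G (P \<union> Q))"
    using PQ P Q uniform True
    by (intro cograph_induced_Un_nonadjacent pair_graph_complement[OF G])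
      (auto simp: induced_complement cograph.complement)
  then have "cograph (graph_complement (graph_complement (induced G (P \<union> Q))))"
    using PQ by (simp add: induced_complement cograph.complement)
  then show ?thesis
    by (simp only: complement_complement[OF pair_graph_induced[OF G Un_least[OF PQ(1,2)]]])
qed


section \<open>Maximal cograph modules\<close>

definition graph_module :: "'a pair_pre_digraph \<Rightarrow> 'a set \<Rightarrow> bool" where
  "graph_module G M \<longleftrightarrow> M \<subseteq> pverts G \<and>
     (\<forall>x\<in>M. \<forall>y\<in>M. \<forall>v\<in>pverts G - M. (x, v) \<in> parcs G \<longleftrightarrow> (y, v) \<in> parcs G)"

definition cograph_module :: "'a pair_pre_digraph \<Rightarrow> 'a set \<Rightarrow> bool" where
  "cograph_module G M \<longleftrightarrow> graph_module G M \<and> cograph (induced G M)"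

definition maximal_cograph_modules :: "'a pair_pre_digraph \<Rightarrow> 'a set set" where
  "maximal_cograph_modules G =
     {M. cograph_module G M \<and> (\<forall>N. cograph_module G N \<and> M \<subseteq> N \<longrightarrow> N = M)}"

text \<open>Distinctness of the blocks keeps the edges inside a block from becoming loops.\<close>

definition quotient_graph :: "'a pair_pre_digraph \<Rightarrow> 'a set set \<Rightarrow> 'a set pair_pre_digraph" where
  "quotient_graph G \<pi> =
     \<lparr> pverts = \<pi>,
       parcs = {(B, C). B \<in> \<pi> \<and> C \<in> \<pi> \<and> B \<noteq> C \<and> (\<exists>u\<in>B. \<exists>v\<in>C. (u, v) \<in> parcs G)} \<rparr>"

lemma graph_moduleD:
  assumes "graph_module G M" "x \<in> M" "y \<in> M" "v \<in> pverts G" "v \<notin> M"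
  shows "(x, v) \<in> parcs G \<longleftrightarrow> (y, v) \<in> parcs G"
  using assms unfolding graph_module_def by blast

lemma cograph_moduleD:
  assumes "cograph_module G M"
  shows "graph_module G M" "cograph (induced G M)" "M \<subseteq> pverts G" "M \<noteq> {}"
  using assms cograph_imp_pair_graph[of "induced G M"]
  unfolding cograph_module_def graph_module_def induced_simps(1) by blast+

lemma cograph_module_singleton:
  assumes "pair_graph G" "v \<in> pverts G"
  shows "cograph_module G {v}"
proof -
  have "induced G {v} = \<lparr>pverts = {v}, parcs = {}\<rparr>"
    using pair_graphD(4)[OF assms(1)] by (intro graph_eqI) auto
  with assms(2) show ?thesis by (simp add: cograph_module_def graph_module_def cograph.single)
qed

text \<open>
  Let \<open>x \<in> M - N\<close> and \<open>y \<in> N - M\<close>. Every pair \<open>p \<in> M\<close>, \<open>q \<in> N - M\<close> has the adjacency of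
  \<open>x\<close> and \<open>y\<close>, because \<open>M\<close> is not distinguished by \<open>q\<close> and \<open>N\<close> is not distinguished by \<open>x\<close>.
  So the union induces the disjoint union or the join of the graphs induced by \<open>M\<close> and \<open>N - M\<close>.
\<close>

lemma cograph_module_Un:
  assumes G: "pair_graph G" and M: "cograph_module G M" and N: "cograph_module G N"
    and MN: "M \<inter> N \<noteq> {}"
  shows "cograph_module G (M \<union> N)"
proof (cases "M \<subseteq> N \<or> N \<subseteq> M")
  case True
  then show ?thesis using M N by (metis sup.absorb1 sup.absorb2)
next
  case False
  then obtain x y where x: "x \<in> M" "x \<notin> N" and y: "y \<in> N" "y \<notin> M" by blast
  note M' = cograph_moduleD[OF M] and N' = cograph_moduleD[OF N]
  obtain w where w: "w \<in> M" "w \<in> N" using MN by blast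
  have "graph_module G (M \<union> N)"
    unfolding graph_module_def
  proof (intro conjI ballI)
    fix a b v assume "a \<in> M \<union> N" "b \<in> M \<union> N" and v: "v \<in> pverts G - (M \<union> N)"
    have "(c, v) \<in> parcs G \<longleftrightarrow> (w, v) \<in> parcs G" if "c \<in> M \<union> N" for c
      using that v w graph_moduleD[OF M'(1), of c w v] graph_moduleD[OF N'(1), of c w v] by blast
    then show "(a, v) \<in> parcs G \<longleftrightarrow> (b, v) \<in> parcs G"
      using \<open>a \<in> M \<union> N\<close> \<open>b \<in> M \<union> N\<close> by blast
  qed (use M'(3) N'(3) in blast)
  moreover have "cograph (induced G (M \<union> (N - M)))"
  proof (rule cograph_induced_Un[OF G])
    have "cograph (induced (induced G N) (N - M))"
      using y by (intro cograph_induced[OF N'(2)]) auto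
    moreover have "induced (induced G N) (N - M) = induced G (N - M)"
      by (intro graph_eqI) auto
    ultimately show "cograph (induced G (N - M))" by simp
    fix p q assume p: "p \<in> M" and q: "q \<in> N - M"
    have "(p, q) \<in> parcs G \<longleftrightarrow> (x, q) \<in> parcs G"
      using graph_moduleD[OF M'(1) p x(1), of q] q N'(3) by blast
    also have "\<dots> \<longleftrightarrow> (x, y) \<in> parcs G"
      using graph_moduleD[OF N'(1), of q y x] q y x M'(3)
        pair_graph_sym_iff[OF G, of x q] pair_graph_sym_iff[OF G, of x y] by auto
    finally show "(p, q) \<in> parcs G \<longleftrightarrow> (x, y) \<in> parcs G" .
  qed (use M' N' in auto)
  ultimately show ?thesis by (simp add: cograph_module_def)
qed

lemma maximal_cograph_module_exists:
  assumes G: "pair_graph G" and N: "cograph_module G N"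
  shows "\<exists>M \<in> maximal_cograph_modules G. N \<subseteq> M"
proof -
  have "{M. cograph_module G M} \<subseteq> Pow (pverts G)" using cograph_moduleD(3) by blast
  then have "finite {M. cograph_module G M}"
    using pair_graphD(1)[OF G] by (metis finite_Pow_iff finite_subset)
  then obtain M where "cograph_module G M" "N \<subseteq> M"
    and "\<And>K. cograph_module G K \<Longrightarrow> M \<subseteq> K \<Longrightarrow> M = K"
    using finite_has_maximal2[of "{M. cograph_module G M}" N] N by blast
  then show ?thesis unfolding maximal_cograph_modules_def by blast
qed

lemma maximal_cograph_module_absorbs:
  assumes "pair_graph G" "M \<in> maximal_cograph_modules G" "cograph_module G N" "M \<inter> N \<noteq> {}"
  shows "N \<subseteq> M"
proof -
  have "cograph_module G (M \<union> N)"
    using assms cograph_module_Un[of G M N] unfolding maximal_cograph_modules_def by blast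
  then have "M \<union> N = M" using assms(2) unfolding maximal_cograph_modules_def by blast
  then show ?thesis by blast
qed

lemma partition_on_maximal_cograph_modules:
  assumes G: "pair_graph G"
  shows "partition_on (pverts G) (maximal_cograph_modules G)"
proof (rule partition_onI)
  have mod: "cograph_module G M" if "M \<in> maximal_cograph_modules G" for M
    using that by (simp add: maximal_cograph_modules_def)
  show "{} \<notin> maximal_cograph_modules G"
    using mod cograph_moduleD(4) by blast
  show "\<Union> (maximal_cograph_modules G) = pverts G"
  proof (intro equalityI subsetI)
    fix v assume "v \<in> \<Union> (maximal_cograph_modules G)"
    then show "v \<in> pverts G" using mod cograph_moduleD(3) by blast
  next
    fix v assume "v \<in> pverts G"
    then show "v \<in> \<Union> (maximal_cograph_modules G)"
      using maximal_cograph_module_exists[OF G cograph_module_singleton[OF G]] by blast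
  qed
  show "disjnt M N"
    if "M \<in> maximal_cograph_modules G" "N \<in> maximal_cograph_modules G" "M \<noteq> N" for M N
    using maximal_cograph_module_absorbs[OF G that(1) mod[OF that(2)]]
      maximal_cograph_module_absorbs[OF G that(2) mod[OF that(1)]] that(3)
    unfolding disjnt_def by blast
qed

lemma quotient_graph_simps [simp]: "pverts (quotient_graph G \<pi>) = \<pi>"
  by (simp add: quotient_graph_def)

text \<open>Between two modules of a partition all adjacencies agree, so any representatives decide.\<close>

lemma quotient_arc_iff:
  assumes G: "pair_graph G" and \<pi>: "partition_on (pverts G) \<pi>"
    and mod: "\<And>B. B \<in> \<pi> \<Longrightarrow> graph_module G B"
    and B: "B \<in> \<pi>" "u \<in> B" and C: "C \<in> \<pi>" "v \<in> C" and "B \<noteq> C"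
  shows "(B, C) \<in> parcs (quotient_graph G \<pi>) \<longleftrightarrow> (u, v) \<in> parcs G"
proof -
  have disj: "B \<inter> C = {}"
    using \<pi> B C \<open>B \<noteq> C\<close> by (auto simp: partition_on_def disjoint_def)
  have sub: "B \<subseteq> pverts G" "C \<subseteq> pverts G"
    using mod B C unfolding graph_module_def by blast+
  have "(u, v) \<in> parcs G" if "(x, y) \<in> parcs G" "x \<in> B" "y \<in> C" for x y
  proof -
    have "(u, y) \<in> parcs G"
      using graph_moduleD[OF mod[OF B(1)], of x u y] that B disj sub by blast
    then show ?thesis
      using graph_moduleD[OF mod[OF C(1)], of y v u] that B C disj sub
        pair_graph_sym_iff[OF G, of u y] pair_graph_sym_iff[OF G, of u v] by auto
  qed
  then show ?thesis using B C \<open>B \<noteq> C\<close> by (auto simp: quotient_graph_def)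
qed

lemma pair_graph_quotient:
  assumes G: "pair_graph G" and \<pi>: "partition_on (pverts G) \<pi>"
  shows "pair_graph (quotient_graph G \<pi>)"
  unfolding pair_graph_iff quotient_graph_def
  using finite_elements[OF pair_graphD(1)[OF G] \<pi>] pair_graphD(3)[OF G]
  by (auto simp: irrefl_def intro!: symI)

text \<open>
  If two blocks are twins in the quotient, then no vertex outside distinguishes them, and they
  induce the disjoint union or the join of two cographs. So their union is a cograph module,
  against maximality.
\<close>

lemma bi_point_determining_quotient_maximal_cograph_modules:
  assumes G: "pair_graph G"
  shows "bi_point_determining (quotient_graph G (maximal_cograph_modules G))"
proof -
  let ?\<pi> = "maximal_cograph_modules G"
  let ?Q = "quotient_graph G ?\<pi>"
  note \<pi> = partition_on_maximal_cograph_modules[OF G]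
  have mod: "cograph_module G B" if "B \<in> ?\<pi>" for B
    using that by (simp add: maximal_cograph_modules_def)
  have arc: "(B, C) \<in> parcs ?Q \<longleftrightarrow> (u, v) \<in> parcs G"
    if "B \<in> ?\<pi>" "u \<in> B" "C \<in> ?\<pi>" "v \<in> C" "B \<noteq> C" for B C u v
    using quotient_arc_iff[OF G \<pi> _ that] mod cograph_moduleD(1) by blast
  have "\<not> twins ?Q B C" for B C
  proof
    assume t: "twins ?Q B C"
    then have B: "B \<in> ?\<pi>" and C: "C \<in> ?\<pi>" and "B \<noteq> C" by (auto simp: twins_def)
    note B' = cograph_moduleD[OF mod[OF B]] and C' = cograph_moduleD[OF mod[OF C]]
    have disj: "B \<inter> C = {}"
      using \<pi> B C \<open>B \<noteq> C\<close> by (auto simp: partition_on_def disjoint_def)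
    have "cograph_module G (B \<union> C)"
      unfolding cograph_module_def
    proof
      show "graph_module G (B \<union> C)"
        unfolding graph_module_def
      proof (intro conjI ballI)
        fix x y v assume "x \<in> B \<union> C" "y \<in> B \<union> C" and v: "v \<in> pverts G - (B \<union> C)"
        obtain D where D: "D \<in> ?\<pi>" "v \<in> D" using v \<pi> by (auto simp: partition_on_def)
        with v have DBC: "B \<noteq> D" "C \<noteq> D" by auto
        then have eq: "(B, D) \<in> parcs ?Q \<longleftrightarrow> (C, D) \<in> parcs ?Q"
          using t D by (auto simp: twins_def)
        have "(z, v) \<in> parcs G \<longleftrightarrow> (B, D) \<in> parcs ?Q" if "z \<in> B \<union> C" for z
          using that arc[OF B _ D DBC(1)] arc[OF C _ D DBC(2)] eq by blast
        then show "(x, v) \<in> parcs G \<longleftrightarrow> (y, v) \<in> parcs G"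
          using \<open>x \<in> B \<union> C\<close> \<open>y \<in> B \<union> C\<close> by blast
      qed (use B'(3) C'(3) in blast)
      show "cograph (induced G (B \<union> C))"
        using arc[OF B _ C _ \<open>B \<noteq> C\<close>] disj
        by (intro cograph_induced_Un[OF G B'(3) C'(3) _ B'(2) C'(2),
              where b = "(B, C) \<in> parcs ?Q"]) auto
    qed
    then have "B \<union> C = B" using B by (simp add: maximal_cograph_modules_def)
    with disj C'(4) show False by blast
  qed
  then show ?thesis by (simp add: bi_point_determining_iff_no_twins pair_graph_quotient[OF G \<pi>])
qed

text \<open>
  A maximal cograph module \<open>M\<close> absorbs every block that it meets. If it contained two
  blocks, then the quotient of \<open>M\<close> by its blocks, realized as an induced subgraph of \<open>M\<close> on
  representatives, would have twins. As \<open>M\<close> is a module, blocks outside \<open>M\<close> do not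
  distinguish them either, so they would be twins in the whole quotient.
\<close>

lemma bi_point_determining_quotient_unique:
  assumes G: "pair_graph G" and \<pi>: "partition_on (pverts G) \<pi>"
    and mod: "\<And>B. B \<in> \<pi> \<Longrightarrow> cograph_module G B"
    and bi: "bi_point_determining (quotient_graph G \<pi>)"
  shows "\<pi> = maximal_cograph_modules G"
proof -
  let ?Q = "quotient_graph G \<pi>"
  note max_part = partition_on_maximal_cograph_modules[OF G]
  have arc: "(B, C) \<in> parcs ?Q \<longleftrightarrow> (u, v) \<in> parcs G"
    if "B \<in> \<pi>" "u \<in> B" "C \<in> \<pi>" "v \<in> C" "B \<noteq> C" for B C u v
    using quotient_arc_iff[OF G \<pi> _ that] mod cograph_moduleD(1) by blast
  have no_twins: "\<not> twins ?Q B C" for B C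
    using bi by (simp add: bi_point_determining_iff_no_twins pair_graph_quotient[OF G \<pi>])
  have same: "B = C" if "B \<in> \<pi>" "C \<in> \<pi>" "z \<in> B" "z \<in> C" for B C z
    using \<pi> that by (auto simp: partition_on_def disjoint_def)
  have eq: "B = M" if B: "B \<in> \<pi>" and M: "M \<in> maximal_cograph_modules G" and "B \<subseteq> M" for B M
  proof (rule ccontr)
    assume "B \<noteq> M"
    have M': "cograph_module G M" using M by (simp add: maximal_cograph_modules_def)
    note M'' = cograph_moduleD[OF M']
    define r where "r C = (SOME z. z \<in> C)" for C :: "'a set"
    have r: "r C \<in> C" if "C \<in> \<pi>" for C
      using cograph_moduleD(4)[OF mod[OF that]] unfolding r_def by (simp add: some_in_eq)
    let ?T = "r ` {C \<in> \<pi>. C \<subseteq> M}"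
    have TM: "?T \<subseteq> M" using r by blast
    from \<open>B \<noteq> M\<close> \<open>B \<subseteq> M\<close> obtain z where z: "z \<in> M" "z \<notin> B" by blast
    then obtain C where C: "C \<in> \<pi>" "z \<in> C" using M''(3) \<pi> by (auto simp: partition_on_def)
    then have CM: "C \<subseteq> M"
      using z maximal_cograph_module_absorbs[OF G M mod[OF C(1)]] by blast
    have "r B \<noteq> r C" using same[OF B C(1)] r[OF B] r[OF C(1)] z C(2) by metis
    have "cograph (induced (induced G M) ?T)"
      using TM B \<open>B \<subseteq> M\<close> by (intro cograph_induced[OF M''(2)]) auto
    moreover have "induced (induced G M) ?T = induced G ?T"
      using TM by (intro graph_eqI) auto
    ultimately have "cograph (induced G ?T)" by simp
    moreover have "r B \<in> pverts (induced G ?T)" "r C \<in> pverts (induced G ?T)"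
      using B \<open>B \<subseteq> M\<close> C(1) CM by auto
    ultimately obtain u v where t: "twins (induced G ?T) u v"
      using cograph_has_twins[OF _ _ _ \<open>r B \<noteq> r C\<close>] by blast
    then obtain D E where DE: "D \<in> \<pi>" "D \<subseteq> M" "u = r D" "E \<in> \<pi>" "E \<subseteq> M" "v = r E" "D \<noteq> E"
      by (auto simp: twins_def)
    have "twins ?Q D E"
      unfolding twins_def
    proof (intro conjI ballI)
      fix F assume F: "F \<in> pverts ?Q - {D, E}"
      then have F': "F \<in> \<pi>" "D \<noteq> F" "E \<noteq> F" by auto
      have "(r D, r F) \<in> parcs G \<longleftrightarrow> (r E, r F) \<in> parcs G"
      proof (cases "F \<subseteq> M")
        case True
        have "r F \<noteq> r D" "r F \<noteq> r E"
          using same[of F D "r F"] same[of F E "r F"] r F' DE by metis+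
        with t True F' DE show ?thesis by (auto simp: twins_def)
      next
        case False
        with maximal_cograph_module_absorbs[OF G M mod[OF F'(1)]] r[OF F'(1)]
        have "r F \<notin> M" by blast
        with graph_moduleD[OF M''(1)] DE r F'(1) cograph_moduleD(3)[OF mod[OF F'(1)]]
        show ?thesis by blast
      qed
      then show "(D, F) \<in> parcs ?Q \<longleftrightarrow> (E, F) \<in> parcs ?Q"
        using arc[OF DE(1) r[OF DE(1)] F'(1) r[OF F'(1)] F'(2)]
          arc[OF DE(4) r[OF DE(4)] F'(1) r[OF F'(1)] F'(3)] by simp
    qed (use DE in auto)
    with no_twins show False by blast
  qed
  show ?thesis
  proof (intro equalityI subsetI)
    fix B assume "B \<in> \<pi>"
    with maximal_cograph_module_exists[OF G mod] eq show "B \<in> maximal_cograph_modules G" by metis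
  next
    fix M assume M: "M \<in> maximal_cograph_modules G"
    then have M': "cograph_module G M" by (simp add: maximal_cograph_modules_def)
    then obtain z where z: "z \<in> M" "z \<in> pverts G" using cograph_moduleD(3,4) by blast
    then obtain B where B: "B \<in> \<pi>" "z \<in> B" using \<pi> by (auto simp: partition_on_def)
    then have "B \<subseteq> M" using z maximal_cograph_module_absorbs[OF G M mod[OF B(1)]] by blast
    with eq B M show "M \<in> \<pi>" by blast
  qed
qed


section \<open>Substitution\<close>

text \<open>The vertices of the outer graph are themselves the vertex sets that are substituted.\<close>

definition substitution ::
    "'a set pair_pre_digraph \<Rightarrow> ('a set \<Rightarrow> 'a pair_pre_digraph) \<Rightarrow> 'a pair_pre_digraph" where
  "substitution \<phi> \<psi> =
     \<lparr> pverts = \<Union> (pverts \<phi>),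
       parcs = (\<Union>B\<in>pverts \<phi>. parcs (\<psi> B)) \<union> (\<Union>(B, C)\<in>parcs \<phi>. B \<times> C) \<rparr>"

lemma substitution_simps [simp]:
  "pverts (substitution \<phi> \<psi>) = \<Union> (pverts \<phi>)"
  "parcs (substitution \<phi> \<psi>) = (\<Union>B\<in>pverts \<phi>. parcs (\<psi> B)) \<union> (\<Union>(B, C)\<in>parcs \<phi>. B \<times> C)"
  by (simp_all add: substitution_def)

lemma substitution_quotient:
  assumes G: "pair_graph G" and \<pi>: "partition_on (pverts G) \<pi>"
    and mod: "\<And>B. B \<in> \<pi> \<Longrightarrow> graph_module G B"
  shows "substitution (quotient_graph G \<pi>) (\<lambda>B\<in>\<pi>. induced G B) = G"
proof (rule graph_eqI)
  show "pverts (substitution (quotient_graph G \<pi>) (\<lambda>B\<in>\<pi>. induced G B)) = pverts G"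
    using \<pi> by (simp add: partition_on_def)
  show "parcs (substitution (quotient_graph G \<pi>) (\<lambda>B\<in>\<pi>. induced G B)) = parcs G" (is "?L = _")
  proof (intro equalityI subrelI)
    fix u v assume "(u, v) \<in> ?L"
    then consider B where "B \<in> \<pi>" "(u, v) \<in> parcs (induced G B)"
      | B C where "(B, C) \<in> parcs (quotient_graph G \<pi>)" "u \<in> B" "v \<in> C"
      by auto
    then show "(u, v) \<in> parcs G"
    proof cases
      case 2
      then have "B \<in> \<pi>" "C \<in> \<pi>" "B \<noteq> C" by (auto simp: quotient_graph_def)
      with quotient_arc_iff[OF G \<pi> mod] 2 show ?thesis by blast
    qed simp
  next
    fix u v assume uv: "(u, v) \<in> parcs G"
    then have "u \<in> \<Union> \<pi>" "v \<in> \<Union> \<pi>"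
      using pair_graphD(2)[OF G uv] partition_onD1[OF \<pi>] by auto
    then obtain B C where "B \<in> \<pi>" "u \<in> B" "C \<in> \<pi>" "v \<in> C" by blast
    with uv show "(u, v) \<in> ?L"
      by (cases "B = C") (auto simp: quotient_graph_def)
  qed
qed

text \<open>
  Since the blocks are disjoint, the arcs inside a block of a substitution come from the inner
  graph and the arcs between two blocks come from the outer graph; so both can be read off.
\<close>

lemma
  assumes \<pi>: "partition_on U \<pi>" and U: "finite U"
    and \<phi>: "pair_graph \<phi>" "pverts \<phi> = \<pi>"
    and \<psi>_blocks: "\<forall>B\<in>\<pi>. pair_graph (\<psi> B) \<and> pverts (\<psi> B) = B"
  shows pair_graph_substitution: "pair_graph (substitution \<phi> \<psi>)"
    and substitution_arc_iff: "\<And>B C u v. B \<in> \<pi> \<Longrightarrow> u \<in> B \<Longrightarrow> C \<in> \<pi> \<Longrightarrow> v \<in> C \<Longrightarrow>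
      (u, v) \<in> parcs (substitution \<phi> \<psi>) \<longleftrightarrow> (if B = C then (u, v) \<in> parcs (\<psi> B) else (B, C) \<in> parcs \<phi>)"
proof -
  note \<psi> = bspec[OF \<psi>_blocks]
  have same: "B = C" if "B \<in> \<pi>" "C \<in> \<pi>" "z \<in> B" "z \<in> C" for B C z
    using \<pi> that by (auto simp: partition_on_def disjoint_def)
  have in_\<psi>: "u \<in> B" "v \<in> B" if "B \<in> \<pi>" "(u, v) \<in> parcs (\<psi> B)" for B u v
    using \<psi>[OF that(1)] pair_graphD(2)[of "\<psi> B" u v] that(2) by auto
  note in_\<phi> = pair_graphD(2)[OF \<phi>(1), unfolded \<phi>(2)]
  note loop = pair_graphD(4)[OF \<phi>(1)]
  let ?G = "substitution \<phi> \<psi>"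
  show arc: "(u, v) \<in> parcs ?G \<longleftrightarrow> (if B = C then (u, v) \<in> parcs (\<psi> B) else (B, C) \<in> parcs \<phi>)"
    if B: "B \<in> \<pi>" "u \<in> B" and C: "C \<in> \<pi>" "v \<in> C" for B C u v
  proof
    assume "(u, v) \<in> parcs ?G"
    then consider D where "D \<in> \<pi>" "(u, v) \<in> parcs (\<psi> D)"
      | D E where "(D, E) \<in> parcs \<phi>" "u \<in> D" "v \<in> E"
      using \<phi>(2) by auto
    then show "if B = C then (u, v) \<in> parcs (\<psi> B) else (B, C) \<in> parcs \<phi>"
    proof cases
      case 1
      then have "D = B" "D = C" using in_\<psi>[OF 1] same B C by blast+
      with 1 show ?thesis by simp
    next
      case 2
      then have "D = B" "E = C" using in_\<phi>[OF 2(1)] same B C by blast+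
      with 2 loop show ?thesis by auto
    qed
  next
    assume "if B = C then (u, v) \<in> parcs (\<psi> B) else (B, C) \<in> parcs \<phi>"
    then show "(u, v) \<in> parcs ?G" using B C \<phi>(2) by (auto split: if_splits)
  qed
  have verts: "pverts ?G = U" using \<pi> \<phi>(2) by (simp add: partition_on_def)
  have sub: "parcs ?G \<subseteq> U \<times> U"
    using in_\<psi> in_\<phi> \<pi> \<phi>(2) unfolding partition_on_def by fastforce
  have block: "\<exists>B\<in>\<pi>. u \<in> B" if "u \<in> U" for u
    using that \<pi> by (auto simp: partition_on_def)
  have "sym (parcs ?G)"
  proof (rule symI)
    fix u v assume uv: "(u, v) \<in> parcs ?G"
    with sub block obtain B C where "B \<in> \<pi>" "u \<in> B" "C \<in> \<pi>" "v \<in> C" by blast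
    with uv arc[of B u C v] arc[of C v B u] pair_graphD(3)[OF \<phi>(1), of B C]
      pair_graphD(3)[of "\<psi> B" u v] \<psi>[of B]
    show "(v, u) \<in> parcs ?G" by (auto split: if_splits simp del: substitution_simps)
  qed
  moreover have "(u, u) \<notin> parcs ?G" for u
  proof
    assume uu: "(u, u) \<in> parcs ?G"
    with sub block obtain B where "B \<in> \<pi>" "u \<in> B" by blast
    with uu arc[of B u B u] pair_graphD(4)[of "\<psi> B" u] \<psi>[of B] show False by metis
  qed
  ultimately show "pair_graph ?G"
    using U sub by (simp add: pair_graph_iff verts irrefl_def del: substitution_simps)
qed

lemma
  assumes \<pi>: "partition_on U \<pi>" and U: "finite U"
    and \<phi>: "pair_graph \<phi>" "pverts \<phi> = \<pi>"
    and \<psi>_blocks: "\<forall>B\<in>\<pi>. pair_graph (\<psi> B) \<and> pverts (\<psi> B) = B"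
  shows quotient_substitution: "quotient_graph (substitution \<phi> \<psi>) \<pi> = \<phi>"
    and induced_substitution: "\<And>B. B \<in> \<pi> \<Longrightarrow> induced (substitution \<phi> \<psi>) B = \<psi> B"
    and graph_module_substitution: "\<And>B. B \<in> \<pi> \<Longrightarrow> graph_module (substitution \<phi> \<psi>) B"
proof -
  let ?G = "substitution \<phi> \<psi>"
  note \<psi> = bspec[OF \<psi>_blocks]
  note arc = substitution_arc_iff[OF assms]
  have nonempty: "\<exists>u. u \<in> B" if "B \<in> \<pi>" for B
    using partition_onD3[OF \<pi>] that by (cases "B = {}") auto
  show "quotient_graph ?G \<pi> = \<phi>"
  proof (rule graph_eqI)
    show "parcs (quotient_graph ?G \<pi>) = parcs \<phi>"
    proof (intro equalityI subrelI)
      fix B C assume "(B, C) \<in> parcs (quotient_graph ?G \<pi>)"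
      then obtain u v where "B \<in> \<pi>" "C \<in> \<pi>" "B \<noteq> C" "u \<in> B" "v \<in> C" "(u, v) \<in> parcs ?G"
        by (auto simp: quotient_graph_def simp del: substitution_simps)
      with arc[of B u C v] show "(B, C) \<in> parcs \<phi>" by simp
    next
      fix B C assume BC: "(B, C) \<in> parcs \<phi>"
      have BC': "B \<in> \<pi>" "C \<in> \<pi>" "B \<noteq> C"
        using pair_graphD(2,4)[OF \<phi>(1)] BC \<phi>(2) by blast+
      then obtain u v where uv: "u \<in> B" "v \<in> C" using nonempty by blast
      with arc[of B u C v] BC BC' have "(u, v) \<in> parcs ?G" by (simp del: substitution_simps)
      with uv BC' show "(B, C) \<in> parcs (quotient_graph ?G \<pi>)"
        by (auto simp: quotient_graph_def simp del: substitution_simps)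
    qed
  qed (simp add: \<phi>(2))
  show "induced ?G B = \<psi> B" if B: "B \<in> \<pi>" for B
  proof (rule graph_eqI)
    show "parcs (induced ?G B) = parcs (\<psi> B)"
      using arc[OF B _ B] pair_graphD(2)[of "\<psi> B"] \<psi>[OF B]
      by (auto simp del: substitution_simps)
  qed (simp add: \<psi> B)
  show "graph_module ?G B" if B: "B \<in> \<pi>" for B
    unfolding graph_module_def
  proof (intro conjI ballI)
    show "B \<subseteq> pverts ?G" using B \<phi>(2) by auto
    fix x y v assume xy: "x \<in> B" "y \<in> B" and v: "v \<in> pverts ?G - B"
    then obtain C where C: "C \<in> \<pi>" "v \<in> C" "B \<noteq> C" using \<phi>(2) by auto
    with arc[OF B xy(1) C(1,2)] arc[OF B xy(2) C(1,2)]
    show "(x, v) \<in> parcs ?G \<longleftrightarrow> (y, v) \<in> parcs ?G" by (simp del: substitution_simps)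
  qed
qed

lemma relabel_substitution:
  assumes "\<And>B. B \<in> pverts \<phi> \<Longrightarrow> \<psi>' (\<sigma> ` B) = relabel \<sigma> (\<psi> B)"
  shows "substitution (relabel (image \<sigma>) \<phi>) \<psi>' = relabel \<sigma> (substitution \<phi> \<psi>)"
proof (rule graph_eqI)
  show "pverts (substitution (relabel (image \<sigma>) \<phi>) \<psi>') = pverts (relabel \<sigma> (substitution \<phi> \<psi>))"
    by (auto simp: relabel_def)
  have "(\<Union>B\<in>image \<sigma> ` pverts \<phi>. parcs (\<psi>' B)) =
      map_prod \<sigma> \<sigma> ` (\<Union>B\<in>pverts \<phi>. parcs (\<psi> B))"
    using assms by (simp add: image_UN relabel_def)
  moreover have "(\<Union>(B, C)\<in>map_prod (image \<sigma>) (image \<sigma>) ` parcs \<phi>. B \<times> C) =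
      map_prod \<sigma> \<sigma> ` (\<Union>(B, C)\<in>parcs \<phi>. B \<times> C)"
    by (fastforce simp: image_UN)
  ultimately show "parcs (substitution (relabel (image \<sigma>) \<phi>) \<psi>') =
      parcs (relabel \<sigma> (substitution \<phi> \<psi>))"
    by (simp add: relabel_def image_Un)
qed


section \<open>The isomorphism of species\<close>

lemma species_iso_sym:
  fixes F :: "('a, 's) species" and G :: "('a, 't) species"
  assumes "species_iso F G"
  shows "species_iso G F"
proof -
  obtain \<alpha> where F: "is_species F" and G: "is_species G" and \<alpha>: "natural_iso F G \<alpha>"
    using assms unfolding species_iso_def by blast
  have bij: "bij_betw (\<alpha> U) (structs F U) (structs G U)" if "finite U" for U
    using \<alpha> that by (simp add: natural_iso_def)
  have nat: "\<alpha> V (transport F U \<sigma> s) = transport G U \<sigma> (\<alpha> U s)"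
    if "s \<in> structs F U" "finite U" "bij_betw \<sigma> U V" for U V \<sigma> s
    using \<alpha> that by (simp add: natural_iso_def)
  let ?\<beta> = "\<lambda>U. the_inv_into (structs F U) (\<alpha> U)"
  have inv: "?\<beta> U (\<alpha> U s) = s" if "finite U" "s \<in> structs F U" for U s
    using bij[OF that(1)] that(2) by (simp add: bij_betw_def the_inv_into_f_f)
  have "natural_iso G F ?\<beta>"
    unfolding natural_iso_def
  proof (intro conjI allI ballI impI)
    fix U :: "'a set" assume "finite U"
    then show "bij_betw (?\<beta> U) (structs G U) (structs F U)"
      by (intro bij_betw_the_inv_into bij)
  next
    fix U V :: "'a set" and \<sigma> t assume "t \<in> structs G U" and U: "finite U \<and> bij_betw \<sigma> U V"
    then obtain s where s: "s \<in> structs F U" "t = \<alpha> U s"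
      using bij[of U] by (auto simp: bij_betw_def)
    have V: "finite V" using U bij_betw_finite by blast
    have "transport F U \<sigma> s \<in> structs F V"
      using transport_in[OF F _ s(1)] U by blast
    from inv[OF V this] show "?\<beta> V (transport G U \<sigma> t) = transport F U \<sigma> (?\<beta> U t)"
      using nat[OF s(1), of \<sigma> V] U inv[of U s] s by simp
  qed
  with F G show ?thesis unfolding species_iso_def by blast
qed

theorem theorem4p4:
  shows "species_iso (graph_species :: ('a, 'a pair_pre_digraph) species)
           (species_comp (bi_point_determining_species :: ('a set, 'a set pair_pre_digraph) species)
                         (cograph_species :: ('a, 'a pair_pre_digraph) species))"
proof (rule species_iso_sym)
  let ?B = "bi_point_determining_species :: ('a set, 'a set pair_pre_digraph) species"
  let ?C = "cograph_species :: ('a, 'a pair_pre_digraph) species"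
  let ?F = "species_comp ?B ?C"
  let ?G = "graph_species :: ('a, 'a pair_pre_digraph) species"
  let ?\<beta> = "\<lambda>(U :: 'a set) (\<pi> :: 'a set set, \<phi>, \<psi>). substitution \<phi> \<psi>"
  have F_iff: "(\<pi>, \<phi>, \<psi>) \<in> structs ?F U \<longleftrightarrow> partition_on U \<pi> \<and>
      (pair_graph \<phi> \<and> pverts \<phi> = \<pi> \<and> bi_point_determining \<phi>) \<and>
      \<psi> \<in> (\<Pi>\<^sub>E B\<in>\<pi>. {H. pair_graph H \<and> pverts H = B \<and> cograph H})" for U \<pi> \<phi> \<psi>
    by (simp add: species_comp_def bi_point_determining_species_def cograph_species_def
        species_of_graphs_def)
  have G_iff: "H \<in> structs ?G U \<longleftrightarrow> pair_graph H \<and> pverts H = U" for H U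
    by (simp add: graph_species_def species_of_graphs_def)
  have inner: "\<forall>B\<in>\<pi>. pair_graph (\<psi> B) \<and> pverts (\<psi> B) = B" "\<forall>B\<in>\<pi>. cograph (\<psi> B)"
    if "(\<pi>, \<phi>, \<psi>) \<in> structs ?F U" for \<pi> \<phi> \<psi> U
    using that unfolding F_iff by (auto simp: PiE_iff)
  have maps: "substitution \<phi> \<psi> \<in> structs ?G U"
    if U: "finite U" and s: "(\<pi>, \<phi>, \<psi>) \<in> structs ?F U" for U \<pi> \<phi> \<psi>
  proof -
    have "partition_on U \<pi>" "pair_graph \<phi>" "pverts \<phi> = \<pi>" using s unfolding F_iff by blast+
    then show ?thesis
      using pair_graph_substitution[OF _ U _ _ inner(1)[OF s]] partition_onD1
      unfolding G_iff by fastforce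
  qed
  have "natural_iso ?F ?G ?\<beta>"
    unfolding natural_iso_def
  proof (intro conjI allI ballI impI)
    fix U :: "'a set" assume U: "finite U"
    let ?\<alpha> = "\<lambda>G. let \<pi> = maximal_cograph_modules G in
      (\<pi>, quotient_graph G \<pi>, \<lambda>B\<in>\<pi>. induced G B)"
    show "bij_betw (?\<beta> U) (structs ?F U) (structs ?G U)"
    proof (rule bij_betw_byWitness[where f' = ?\<alpha>])
      show "\<forall>s\<in>structs ?F U. ?\<alpha> (?\<beta> U s) = s"
      proof
        fix s assume "s \<in> structs ?F U"
        then obtain \<pi> \<phi> \<psi> where s: "s = (\<pi>, \<phi>, \<psi>)" and in_F: "(\<pi>, \<phi>, \<psi>) \<in> structs ?F U"
          by (cases s) auto
        let ?H = "substitution \<phi> \<psi>"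
        have \<pi>: "partition_on U \<pi>" and \<phi>: "pair_graph \<phi>" "pverts \<phi> = \<pi>" "bi_point_determining \<phi>"
          and ext: "\<psi> \<in> extensional \<pi>"
          using in_F unfolding F_iff by (auto simp: PiE_iff)
        note quot = quotient_substitution[OF \<pi> U \<phi>(1,2) inner(1)[OF in_F]]
          and ind = induced_substitution[OF \<pi> U \<phi>(1,2) inner(1)[OF in_F]]
          and mod = graph_module_substitution[OF \<pi> U \<phi>(1,2) inner(1)[OF in_F]]
        have H: "pair_graph ?H" "pverts ?H = U" using maps[OF U in_F] unfolding G_iff by auto
        have "\<pi> = maximal_cograph_modules ?H"
        proof (rule bi_point_determining_quotient_unique[OF H(1)])
          show "partition_on (pverts ?H) \<pi>" using \<pi> unfolding H(2) .
          show "cograph_module ?H B" if "B \<in> \<pi>" for B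
            using mod[OF that] ind[OF that] inner(2)[OF in_F] that
            unfolding cograph_module_def by simp
          show "bi_point_determining (quotient_graph ?H \<pi>)" using quot \<phi>(3) by simp
        qed
        moreover have "(\<lambda>B\<in>\<pi>. induced ?H B) = \<psi>"
          by (rule extensionalityI[of _ \<pi>]) (use ext ind in auto)
        ultimately show "?\<alpha> (?\<beta> U s) = s" using quot by (simp add: s Let_def)
      qed
      have reassembled: "?\<alpha> H \<in> structs ?F U \<and> ?\<beta> U (?\<alpha> H) = H" if "H \<in> structs ?G U" for H
      proof -
        let ?\<pi> = "maximal_cograph_modules H"
        have H: "pair_graph H" "pverts H = U" using that unfolding G_iff by auto
        note \<pi> = partition_on_maximal_cograph_modules[OF H(1)]
        have mod: "cograph_module H B" if "B \<in> ?\<pi>" for B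
          using that by (simp add: maximal_cograph_modules_def)
        have "(?\<pi>, quotient_graph H ?\<pi>, \<lambda>B\<in>?\<pi>. induced H B) \<in> structs ?F U"
          unfolding F_iff
          using \<pi> H pair_graph_quotient[OF H(1) \<pi>] cograph_moduleD(2,3)[OF mod]
            bi_point_determining_quotient_maximal_cograph_modules[OF H(1)]
            pair_graph_induced[OF H(1)]
          by auto
        moreover have "substitution (quotient_graph H ?\<pi>) (\<lambda>B\<in>?\<pi>. induced H B) = H"
          by (rule substitution_quotient[OF H(1) \<pi>]) (rule cograph_moduleD(1)[OF mod])
        ultimately show ?thesis by (simp add: Let_def)
      qed
      show "\<forall>H\<in>structs ?G U. ?\<beta> U (?\<alpha> H) = H" using reassembled by blast
      show "?\<alpha> ` structs ?G U \<subseteq> structs ?F U" using reassembled by blast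
      show "?\<beta> U ` structs ?F U \<subseteq> structs ?G U" using maps[OF U] by auto
    qed
  next
    fix U V :: "'a set" and \<sigma> s
    assume "s \<in> structs ?F U" and \<sigma>: "finite U \<and> bij_betw \<sigma> U V"
    then obtain \<pi> \<phi> \<psi> where s: "s = (\<pi>, \<phi>, \<psi>)" and in_F: "(\<pi>, \<phi>, \<psi>) \<in> structs ?F U"
      by (cases s) auto
    have \<pi>: "partition_on U \<pi>" and \<phi>: "pverts \<phi> = \<pi>" using in_F unfolding F_iff by auto
    have inj: "inj_on (image \<sigma>) \<pi>"
      using \<pi> \<sigma> by (intro inj_on_image) (simp add: partition_on_def bij_betw_def)
    let ?\<psi>' = "\<lambda>C\<in>image \<sigma> ` \<pi>. let B = the_inv_into \<pi> (image \<sigma>) C in relabel \<sigma> (\<psi> B)"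
    have "substitution (relabel (image \<sigma>) \<phi>) ?\<psi>' = relabel \<sigma> (substitution \<phi> \<psi>)"
      by (rule relabel_substitution) (simp add: \<phi> the_inv_into_f_f[OF inj])
    then show "?\<beta> V (transport ?F U \<sigma> s) = transport ?G U \<sigma> (?\<beta> U s)"
      by (simp add: s species_comp_def bi_point_determining_species_def cograph_species_def
          graph_species_def species_of_graphs_def)
  qed
  then show "species_iso ?F ?G"
    unfolding species_iso_def
    using is_species_comp[OF is_species_bi_point_determining_species is_species_cograph_species]
      is_species_graph_species by blast
qed

end
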